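(* A topological space $X$ is $\kappa$-Fréchet--Urysohn if and only if each point $x\in X$ is contained in a dense $\kappa$-Fréchet--Urysohn subspace of $X$.
   Context: A topological space $X$ is $\kappa$-Fréchet--Urysohn if for every open subset $U$ of $X$ and every $x\in\overline{U}$ there exists a sequence $\{x_n\}_{n\in\mathbb{N}}\subseteq U$ converging to $x$. Subspaces carry the subspace topology. *)

theory Defs
  imports "HOL-Analysis.Analysis"
begin

definition kappa_Frechet_Urysohn_space :: "'a topology \<Rightarrow> bool" where
  "kappa_Frechet_Urysohn_space X \<longleftrightarrow>
     (\<forall>U x. openin X U \<and> x \<in> X closure_of U \<longrightarrow>
        (\<exists>\<sigma>::nat \<Rightarrow> 'a. range \<sigma> \<subseteq> U \<and> limitin X \<sigma> x sequentially))"

end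

theory Submission
  imports Defs
begin

text \<open>An open set \<open>U\<close> and its trace \<open>U \<inter> D\<close> on a dense set
  \<open>D\<close> have the same closure. So if \<open>x\<close> lies in the closure of
  \<open>U\<close> and in \<open>D\<close>, then \<open>x\<close> is adherent to
  \<open>U \<inter> D\<close> within \<open>D\<close>, and a sequence found in the subspace also
  works in \<open>X\<close>. The key lemma is \<open>closure_of_openin_Int_superset\<close>.\<close>

theorem theorem2p1:
  fixes X :: "'a topology"
  shows "kappa_Frechet_Urysohn_space X \<longleftrightarrow>
    (\<forall>x \<in> topspace X. \<exists>D. D \<subseteq> topspace X \<and> x \<in> D \<and>
       X closure_of D = topspace X \<and> kappa_Frechet_Urysohn_space (subtopology X D))"
    (is "_ \<longleftrightarrow> ?R")
proof
  assume "kappa_Frechet_Urysohn_space X"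
  then show ?R
    \<comment> \<open>The whole space serves as the dense subspace for every point.\<close>
    by (intro ballI exI[of _ "topspace X"]) (simp add: subtopology_topspace)
next
  assume R: ?R
  show "kappa_Frechet_Urysohn_space X"
    unfolding kappa_Frechet_Urysohn_space_def
  proof (intro allI impI, elim conjE)
    fix U x
    assume U: "openin X U" and x: "x \<in> X closure_of U"
    then have "x \<in> topspace X"
      by (simp add: in_closure_of)
    with R obtain D where "x \<in> D" and dense: "X closure_of D = topspace X"
      and D: "kappa_Frechet_Urysohn_space (subtopology X D)"
      by blast
    have "X closure_of (U \<inter> D) = X closure_of U"
      using U dense by (simp add: closure_of_openin_Int_superset openin_subset)
    \<comment> \<open>Closure in the subspace is the trace on \<open>D\<close> of closure in
      \<open>X\<close>, so \<open>x \<in> D\<close> matters here: \<open>D\<close> is chosen after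
      \<open>x\<close>.\<close>
    with x \<open>x \<in> D\<close> have "x \<in> subtopology X D closure_of (U \<inter> D)"
      by (simp add: closure_of_subtopology Int_ac)
    moreover have "openin (subtopology X D) (U \<inter> D)"
      using U by (auto simp: openin_subtopology)
    ultimately obtain \<sigma> :: "nat \<Rightarrow> 'a" where "range \<sigma> \<subseteq> U \<inter> D"
      and "limitin (subtopology X D) \<sigma> x sequentially"
      using D unfolding kappa_Frechet_Urysohn_space_def by blast
    then show "\<exists>\<sigma>::nat \<Rightarrow> 'a. range \<sigma> \<subseteq> U \<and> limitin X \<sigma> x sequentially"
      \<comment> \<open>Convergence in a subspace implies convergence in \<open>X\<close> to the
        same point.\<close>
      by (auto simp: limitin_subtopology)
  qed
qed

end
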